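(* Consider the explicit MRSU scheme for the one-dimensional linear convection equation $\partial_tU+c\,\partial_xU=0$ with periodic boundary conditions (the fully discrete scheme, the matrices $M,C,D$ and the notion of critical time step are given in the context). The critical time step $\Delta t_{\mathrm{cr}}$ satisfies the (implicit) inequality $$\Delta t_{\mathrm{cr}}\le\frac{1}{\varrho\left(\frac{I}{\Delta t}-M^{-1}\left[c\,C+\frac{h}{2}\lambda^hD\right]\right)},\qquad \Delta t=\Delta t_{\mathrm{cr}},$$ where $\varrho$ denotes the spectral radius of a matrix.
   Context: Let $c\in\mathbb{R}$ be the constant wave speed, and let the interval $\Omega^h$ be divided into elements of length $h>0$, with periodic boundary conditions. Let $N^h$ be the row vector of continuous piecewise linear (Lagrange) finite element basis functions on this periodic mesh, and define the mass, convection and diffusion matrices $$M=\int_{\Omega^h}(N^h)^TN^h\,d\Omega^h,\qquad C=\int_{\Omega^h}(N^h)^T\frac{dN^h}{dx}\,d\Omega^h,\qquad D=\int_{\Omega^h}\Big(\frac{dN^h}{dx}\Big)^T\frac{dN^h}{dx}\,d\Omega^h .$$ Let $\lambda^h>0$ be the constant magnitude of the discrete velocities (numerical characteristic speed) of the scheme. The fully discrete explicit (forward Euler) MRSU (Method of Relaxed Streamline Upwinding) scheme with time step $\Delta t>0$ is $$(U^h)^{n+1}=\mathcal{A}\,(U^h)^n,\qquad \mathcal{A}=I-\Delta t\,M^{-1}\Big(c\,C+\frac{h}{2}\lambda^hD\Big),$$ where $(U^h)^n$ is the vector of nodal values at time level $n$, $I$ is the identity matrix and $\mathcal{A}$ is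 the amplification matrix. The scheme with time step $\Delta t$ is called stable if its amplification matrix satisfies $\|\mathcal{A}^{n+1}\|\le1$ for all $n\in\mathbb{N}$, where $\|\cdot\|$ is a matrix norm (submultiplicative). The critical time step $\Delta t_{\mathrm{cr}}$ is the maximum time step $\Delta t$ for which the scheme is stable. *)

theory Defs
  imports "HOL-Analysis.Analysis" "Jordan_Normal_Form.Spectral_Radius"
begin

text \<open>
  The periodic interval is \<open>{a..a + n * h}\<close>, split into \<open>n\<close> elements of length \<open>h\<close>. Its nodes are
  \<open>a + j * h\<close> for integers \<open>j\<close>, identified modulo \<open>n\<close>, so that the nodal basis functions are
  indexed by \<open>i < n\<close>. A point \<open>x\<close> lies in element \<open>\<lfloor>(x - a) / h\<rfloor>\<close> and has the
  fractional part of \<open>(x - a) / h\<close> as its local coordinate; the element contributes one linear shape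
  function to each of its two end nodes. The formula also covers \<open>n = 1\<close> and \<open>n = 2\<close>, where
  supports overlap periodically.
\<close>

definition node :: "real \<Rightarrow> real \<Rightarrow> int \<Rightarrow> real" where
  "node a h j = a + of_int j * h"

definition basis_fun :: "nat \<Rightarrow> real \<Rightarrow> real \<Rightarrow> nat \<Rightarrow> real \<Rightarrow> real" where
  "basis_fun n a h i x =
     (let e = \<lfloor>(x - a) / h\<rfloor>; s = frac ((x - a) / h) in
        (if e mod int n = int i then 1 - s else 0)
      + (if (e + 1) mod int n = int i then s else 0))"

lemma basis_fun_node:
  assumes "h > 0"
  shows "basis_fun n a h i (node a h j) = (if j mod int n = int i then 1 else 0)"
  using assms by (simp add: basis_fun_def node_def Let_def)

text \<open>Linear interpolation on closed elements, hence continuity across the nodes.\<close>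

lemma basis_fun_linear:
  assumes h: "h > 0" and x: "node a h e \<le> x" "x \<le> node a h (e + 1)"
  shows "basis_fun n a h i x =
           basis_fun n a h i (node a h e) * ((node a h (e + 1) - x) / h)
         + basis_fun n a h i (node a h (e + 1)) * ((x - node a h e) / h)"
proof (cases "x = node a h (e + 1)")
  case True
  then show ?thesis using h by (simp add: node_def field_simps)
next
  case False
  define s where "s = (x - a) / h - of_int e"
  have s: "0 \<le> s" "s < 1"
    using False x h by (auto simp: s_def node_def field_simps)
  then have fl: "\<lfloor>(x - a) / h\<rfloor> = e"
    unfolding s_def by linarith
  then have fr: "frac ((x - a) / h) = s"
    by (simp add: frac_def s_def)
  have "(node a h (e + 1) - x) / h = 1 - s" "(x - node a h e) / h = s"
    using h by (simp_all add: s_def node_def field_simps)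
  then show ?thesis
    unfolding basis_fun_node[OF h] by (simp add: basis_fun_def Let_def fl fr)
qed

text \<open>
  The basis functions are not differentiable at (some of) the nodes, where \<open>deriv\<close> is unspecified;
  these are finitely many points of the interval and do not affect the integrals.
\<close>

definition mass_matrix :: "nat \<Rightarrow> real \<Rightarrow> real \<Rightarrow> real mat" where
  "mass_matrix n a h = mat n n (\<lambda>(i, j).
     integral {a..a + real n * h} (\<lambda>x. basis_fun n a h i x * basis_fun n a h j x))"

definition convection_matrix :: "nat \<Rightarrow> real \<Rightarrow> real \<Rightarrow> real mat" where
  "convection_matrix n a h = mat n n (\<lambda>(i, j).
     integral {a..a + real n * h} (\<lambda>x. basis_fun n a h i x * deriv (basis_fun n a h j) x))"

definition diffusion_matrix :: "nat \<Rightarrow> real \<Rightarrow> real \<Rightarrow> real mat" where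
  "diffusion_matrix n a h = mat n n (\<lambda>(i, j).
     integral {a..a + real n * h} (\<lambda>x. deriv (basis_fun n a h i) x * deriv (basis_fun n a h j) x))"

text \<open>
  The mass matrix is the Gram matrix of the linearly independent basis functions and so
  is nonsingular for \<open>h > 0\<close> and \<open>n \<ge> 1\<close>: \<open>mat_inverse\<close> returns \<open>Some\<close> of its inverse.
\<close>

definition mrsu_matrix :: "nat \<Rightarrow> real \<Rightarrow> real \<Rightarrow> real \<Rightarrow> real \<Rightarrow> real mat" where
  "mrsu_matrix n a h c lam =
     the (mat_inverse (mass_matrix n a h)) *
       (c \<cdot>\<^sub>m convection_matrix n a h + (h / 2 * lam) \<cdot>\<^sub>m diffusion_matrix n a h)"

definition amplification_matrix ::
  "nat \<Rightarrow> real \<Rightarrow> real \<Rightarrow> real \<Rightarrow> real \<Rightarrow> real \<Rightarrow> real mat" where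
  "amplification_matrix n a h c lam dt = 1\<^sub>m n - dt \<cdot>\<^sub>m mrsu_matrix n a h c lam"

definition submultiplicative_norm :: "nat \<Rightarrow> (real mat \<Rightarrow> real) \<Rightarrow> bool" where
  "submultiplicative_norm n nrm \<longleftrightarrow>
     (\<forall>A \<in> carrier_mat n n. 0 \<le> nrm A \<and> (nrm A = 0 \<longleftrightarrow> A = 0\<^sub>m n n)) \<and>
     (\<forall>A \<in> carrier_mat n n. \<forall>r. nrm (r \<cdot>\<^sub>m A) = \<bar>r\<bar> * nrm A) \<and>
     (\<forall>A \<in> carrier_mat n n. \<forall>B \<in> carrier_mat n n. nrm (A + B) \<le> nrm A + nrm B) \<and>
     (\<forall>A \<in> carrier_mat n n. \<forall>B \<in> carrier_mat n n. nrm (A * B) \<le> nrm A * nrm B)"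

definition mrsu_stable ::
  "(real mat \<Rightarrow> real) \<Rightarrow> nat \<Rightarrow> real \<Rightarrow> real \<Rightarrow> real \<Rightarrow> real \<Rightarrow> real \<Rightarrow> bool" where
  "mrsu_stable nrm n a h c lam dt \<longleftrightarrow>
     (\<forall>k. nrm (amplification_matrix n a h c lam dt ^\<^sub>m (k + 1)) \<le> 1)"

definition critical_time_step ::
  "(real mat \<Rightarrow> real) \<Rightarrow> nat \<Rightarrow> real \<Rightarrow> real \<Rightarrow> real \<Rightarrow> real \<Rightarrow> real \<Rightarrow> bool" where
  "critical_time_step nrm n a h c lam dt \<longleftrightarrow>
     dt > 0 \<and> mrsu_stable nrm n a h c lam dt \<and>
     (\<forall>dt' > 0. mrsu_stable nrm n a h c lam dt' \<longrightarrow> dt' \<le> dt)"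

end

theory Submission
  imports Defs
begin

text \<open>
  Write \<open>K = M\<^sup>-\<^sup>1 (c C + (h / 2) \<lambda> D)\<close> and let \<open>\<Delta>t\<close> be the critical step. The matrix whose
  spectral radius is taken is \<open>B = I / \<Delta>t - K\<close>, and the amplification matrix is \<open>A = \<Delta>t B\<close>.
  The inequality amounts to \<open>0 < \<rho>(B) \<le> 1 / \<Delta>t\<close>. The lower bound is as essential as the upper
  one: because \<open>1 / 0 = 0\<close>, the claim would fail for a nilpotent \<open>B\<close>.

  The upper bound is stability: the powers of \<open>A\<close> are bounded in a submultiplicative norm, hence
  entrywise, whereas an eigenvalue of modulus above 1 would make some entry grow exponentially
  along its eigenvector (\<open>eigenvalue_le_1_of_power_bounded\<close>). The norm is defined on real matrices
  only and eigenvectors may be complex, so the argument passes through entries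
  (\<open>submultiplicative_norm_bounds_entry\<close>) instead of an operator norm.

  The lower bound is conservation of constants: the nodal basis sums to 1, so the derivatives of
  the basis functions sum to 0 inside every element, and \<open>C\<close> and \<open>D\<close> annihilate the constant
  vector. Therefore \<open>K\<close> does too (\<open>mrsu_matrix_annihilates_constants\<close>), and \<open>1 / \<Delta>t\<close> is an
  eigenvalue of \<open>B\<close>. In particular \<open>\<rho>(B) = 1 / \<Delta>t\<close>.

  Both bounds presuppose that \<open>M\<close> is invertible. It is the Gram matrix of the nodal basis, and
  a combination of basis functions with zero \<open>L\<^sup>2\<close> norm vanishes at all nodes, where its values
  are its coefficients (\<open>mass_matrix_kernel\<close>).
\<close>

section \<open>Entries of a matrix and submultiplicative norms\<close>

definition unit_matrix :: "nat \<Rightarrow> nat \<Rightarrow> nat \<Rightarrow> real mat" where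
  "unit_matrix n i j = mat n n (\<lambda>(p, q). if p = i \<and> q = j then 1 else 0)"

lemma unit_matrix_carrier [simp]: "unit_matrix n i j \<in> carrier_mat n n"
  by (simp add: unit_matrix_def)

lemma unit_matrix_sandwich:
  assumes B: "B \<in> carrier_mat n n" and i: "i < n" and j: "j < n"
  shows "unit_matrix n i i * B * unit_matrix n j j = B $$ (i, j) \<cdot>\<^sub>m unit_matrix n i j"
proof (rule eq_matI)
  fix p q assume "p < dim_row (B $$ (i, j) \<cdot>\<^sub>m unit_matrix n i j)"
    and "q < dim_col (B $$ (i, j) \<cdot>\<^sub>m unit_matrix n i j)"
  then have pq: "p < n" "q < n" by (auto simp: unit_matrix_def)
  have EB: "(unit_matrix n i i * B) $$ (p, k) = (if p = i then B $$ (i, k) else 0)"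
    if "k < n" for k
  proof -
    have "(unit_matrix n i i * B) $$ (p, k)
        = (\<Sum>l\<in>{0..<n}. unit_matrix n i i $$ (p, l) * B $$ (l, k))"
      using that B pq by (simp add: unit_matrix_def scalar_prod_def)
    also have "\<dots> = (\<Sum>l\<in>{0..<n}. (if l = i then (if p = i then B $$ (i, k) else 0) else 0))"
      using that pq by (intro sum.cong) (auto simp: unit_matrix_def)
    also have "\<dots> = (if p = i then B $$ (i, k) else 0)"
      using i by (subst sum.delta) auto
    finally show ?thesis .
  qed
  have "(unit_matrix n i i * B * unit_matrix n j j) $$ (p, q)
      = (\<Sum>k\<in>{0..<n}. (unit_matrix n i i * B) $$ (p, k) * unit_matrix n j j $$ (k, q))"
    using B pq by (simp add: scalar_prod_def unit_matrix_def del: index_mult_mat(1))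
      (auto simp: scalar_prod_def intro!: sum.cong)
  also have "\<dots> = (\<Sum>k\<in>{0..<n}. (if k = j then
      (if p = i \<and> q = j then B $$ (i, j) else 0) else 0))"
  proof (rule sum.cong[OF refl])
    fix k assume "k \<in> {0..<n}"
    then have k: "k < n" by simp
    show "(unit_matrix n i i * B) $$ (p, k) * unit_matrix n j j $$ (k, q)
        = (if k = j then (if p = i \<and> q = j then B $$ (i, j) else 0) else 0)"
      unfolding EB[OF k] using k pq by (auto simp: unit_matrix_def)
  qed
  also have "\<dots> = (if p = i \<and> q = j then B $$ (i, j) else 0)"
    using j by (subst sum.delta) auto
  finally show "(unit_matrix n i i * B * unit_matrix n j j) $$ (p, q)
      = (B $$ (i, j) \<cdot>\<^sub>m unit_matrix n i j) $$ (p, q)"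
    using pq by (simp add: unit_matrix_def)
qed (use B in \<open>auto simp: unit_matrix_def\<close>)

text \<open>
  Sandwiching \<open>B\<close> between diagonal matrix units isolates one entry, as a multiple of a fixed
  nonzero matrix; taking norms bounds that entry. This replaces the equivalence of norms on a
  finite-dimensional space.
\<close>

lemma submultiplicative_norm_bounds_entry:
  assumes nrm: "submultiplicative_norm n nrm" and ij: "i < n" "j < n"
  obtains K where "\<And>B. B \<in> carrier_mat n n \<Longrightarrow> \<bar>B $$ (i, j)\<bar> \<le> K * nrm B"
proof
  let ?E = "unit_matrix n"
  fix B :: "real mat" assume B: "B \<in> carrier_mat n n"
  have nonneg: "\<And>A. A \<in> carrier_mat n n \<Longrightarrow> 0 \<le> nrm A"
    and zero: "\<And>A. A \<in> carrier_mat n n \<Longrightarrow> nrm A = 0 \<longleftrightarrow> A = 0\<^sub>m n n"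
    and scale: "\<And>A r. A \<in> carrier_mat n n \<Longrightarrow> nrm (r \<cdot>\<^sub>m A) = \<bar>r\<bar> * nrm A"
    and submult: "\<And>A B. A \<in> carrier_mat n n \<Longrightarrow> B \<in> carrier_mat n n \<Longrightarrow>
      nrm (A * B) \<le> nrm A * nrm B"
    using nrm by (simp_all add: submultiplicative_norm_def)
  have "?E i j $$ (i, j) \<noteq> 0\<^sub>m n n $$ (i, j)"
    using ij by (simp add: unit_matrix_def)
  then have "nrm (?E i j) \<noteq> 0"
    using zero[of "?E i j"] by auto
  then have pos: "0 < nrm (?E i j)"
    using nonneg[of "?E i j"] by simp
  have "\<bar>B $$ (i, j)\<bar> * nrm (?E i j) = nrm (?E i i * B * ?E j j)"
    by (simp add: unit_matrix_sandwich[OF B ij] scale)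
  also have "\<dots> \<le> nrm (?E i i * B) * nrm (?E j j)"
    using B by (intro submult mult_carrier_mat[of _ n n]) auto
  also have "\<dots> \<le> (nrm (?E i i) * nrm B) * nrm (?E j j)"
    using B by (intro mult_right_mono submult nonneg) auto
  finally show "\<bar>B $$ (i, j)\<bar> \<le> (nrm (?E i i) * nrm (?E j j) / nrm (?E i j)) * nrm B"
    using pos by (simp add: field_simps)
qed

section \<open>Power-bounded matrices\<close>

text \<open>
  At a nonzero component \<open>i\<close> of the eigenvector, \<open>\<mu>\<^sup>k v\<^sub>i\<close> is a combination of the entries in row
  \<open>i\<close> of \<open>A\<^sup>k\<close>, which stay bounded in \<open>k\<close>.
\<close>

lemma eigenvalue_le_1_of_power_bounded:
  assumes nrm: "submultiplicative_norm n nrm" and A: "A \<in> carrier_mat n n"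
    and bound: "\<And>k. nrm (A ^\<^sub>m (k + 1)) \<le> 1"
    and ev: "eigenvector (map_mat complex_of_real A) v \<mu>"
  shows "norm \<mu> \<le> 1"
proof (rule ccontr)
  assume gt: "\<not> norm \<mu> \<le> 1"
  let ?A = "map_mat complex_of_real A"
  have A': "?A \<in> carrier_mat n n" using A by simp
  have v: "v \<in> carrier_vec n" "v \<noteq> 0\<^sub>v n" using ev A by (auto simp: eigenvector_def)
  obtain i where i: "i < n" "v $ i \<noteq> 0"
    using v by (metis carrier_vecD eq_vecI index_zero_vec(1,2))
  have "\<forall>j\<in>{..<n}. \<exists>K. \<forall>B\<in>carrier_mat n n. \<bar>B $$ (i, j)\<bar> \<le> K * nrm B"
    using submultiplicative_norm_bounds_entry[OF nrm i(1)] by (metis lessThan_iff)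
  then obtain K where K: "\<And>j B. j < n \<Longrightarrow> B \<in> carrier_mat n n \<Longrightarrow> \<bar>B $$ (i, j)\<bar> \<le> K j * nrm B"
    by (metis lessThan_iff)
  have entry: "\<bar>(A ^\<^sub>m (k + 1)) $$ (i, j)\<bar> \<le> \<bar>K j\<bar>" if "j < n" for j k
  proof -
    have nn: "0 \<le> nrm (A ^\<^sub>m (k + 1))"
      using nrm A unfolding submultiplicative_norm_def by (meson pow_carrier_mat)
    have "\<bar>(A ^\<^sub>m (k + 1)) $$ (i, j)\<bar> \<le> K j * nrm (A ^\<^sub>m (k + 1))"
      using K[OF that pow_carrier_mat[OF A]] .
    also have "\<dots> \<le> \<bar>K j\<bar> * nrm (A ^\<^sub>m (k + 1))"
      using nn by (intro mult_right_mono) auto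
    also have "\<dots> \<le> \<bar>K j\<bar> * 1"
      using bound by (intro mult_left_mono) auto
    finally show ?thesis by simp
  qed
  have le: "norm \<mu> ^ (k + 1) * norm (v $ i) \<le> (\<Sum>j\<in>{0..<n}. \<bar>K j\<bar> * norm (v $ j))" for k
  proof -
    define P where "P = A ^\<^sub>m (k + 1)"
    have P: "P \<in> carrier_mat n n" unfolding P_def using A by (rule pow_carrier_mat)
    have hom: "?A ^\<^sub>m (k + 1) = map_mat complex_of_real P"
      unfolding P_def using of_real_hom.mat_hom_pow[OF A] by metis
    have "\<mu> ^ (k + 1) * v $ i = (?A ^\<^sub>m (k + 1) *\<^sub>v v) $ i"
      unfolding eigenvector_pow[OF A' ev] using i v by simp
    also have "\<dots> = (\<Sum>j\<in>{0..<n}. of_real (P $$ (i, j)) * v $ j)"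
      unfolding hom using P i(1) v(1) by (simp add: scalar_prod_def)
    finally have "norm \<mu> ^ (k + 1) * norm (v $ i)
        = norm (\<Sum>j\<in>{0..<n}. of_real (P $$ (i, j)) * v $ j)"
      by (metis norm_mult norm_power)
    also have "\<dots> \<le> (\<Sum>j\<in>{0..<n}. \<bar>K j\<bar> * norm (v $ j))"
      using entry[of _ k, folded P_def]
      by (intro sum_norm_le) (auto simp: norm_mult intro!: mult_right_mono)
    finally show ?thesis .
  qed
  let ?S = "\<Sum>j\<in>{0..<n}. \<bar>K j\<bar> * norm (v $ j)"
  have vi: "0 < norm (v $ i)" using i by simp
  obtain m where m: "?S / norm (v $ i) < norm \<mu> ^ m"
    using gt real_arch_pow[of "norm \<mu>"] by auto
  also have "\<dots> \<le> norm \<mu> ^ (m + 1)"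
    using gt by (intro power_increasing) auto
  finally have "?S < norm \<mu> ^ (m + 1) * norm (v $ i)"
    using vi by (simp only: divide_less_eq if_True)
  with le[of m] show False by simp
qed

section \<open>Elementwise continuous functions\<close>

text \<open>
  The extension \<open>g\<close> to the closed element is what gives integrability, since \<open>f\<close> may be unbounded
  near the nodes otherwise. The values of \<open>f\<close> at the nodes are left free, which accommodates the
  unspecified derivatives of the basis functions there.
\<close>

definition element_continuous :: "real \<Rightarrow> real \<Rightarrow> (real \<Rightarrow> real) \<Rightarrow> bool" where
  "element_continuous a h f \<longleftrightarrow>
     (\<forall>e. \<exists>g. continuous_on {node a h e..node a h (e + 1)} g \<and>
            (\<forall>x\<in>{node a h e<..<node a h (e + 1)}. f x = g x))"

lemma element_continuous_mult:
  assumes "element_continuous a h f" "element_continuous a h g"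
  shows "element_continuous a h (\<lambda>x. f x * g x)"
  unfolding element_continuous_def
proof
  fix e
  obtain f' where "continuous_on {node a h e..node a h (e + 1)} f'"
      "\<forall>x\<in>{node a h e<..<node a h (e + 1)}. f x = f' x"
    using assms(1) unfolding element_continuous_def by meson
  moreover obtain g' where "continuous_on {node a h e..node a h (e + 1)} g'"
      "\<forall>x\<in>{node a h e<..<node a h (e + 1)}. g x = g' x"
    using assms(2) unfolding element_continuous_def by meson
  ultimately show "\<exists>p. continuous_on {node a h e..node a h (e + 1)} p \<and>
      (\<forall>x\<in>{node a h e<..<node a h (e + 1)}. f x * g x = p x)"
    by (intro exI[of _ "\<lambda>x. f' x * g' x"]) (auto intro: continuous_on_mult)
qed

lemma element_continuous_integrable:
  assumes h: "h > 0" and f: "element_continuous a h f"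
  shows "f integrable_on {a..a + real m * h}"
proof (induction m)
  case 0
  then show ?case using integrable_on_refl[of f a] by simp
next
  case (Suc m)
  have node: "node a h (int m) = a + real m * h" "node a h (int m + 1) = a + real (Suc m) * h"
    by (simp_all add: node_def)
  obtain g where g: "continuous_on {a + real m * h..a + real (Suc m) * h} g"
      and fg: "\<And>x. x \<in> {a + real m * h<..<a + real (Suc m) * h} \<Longrightarrow> f x = g x"
    using f unfolding element_continuous_def node[symmetric] by meson
  have "f integrable_on cbox (a + real m * h) (a + real (Suc m) * h)"
    using fg g by (intro integrable_spike_interior[of _ _ f g])
      (auto simp: box_real intro!: integrable_continuous_real simp del: of_nat_Suc)
  then have "f integrable_on {a + real m * h..a + real (Suc m) * h}"
    by simp
  with Suc show ?case
    using h by (intro Henstock_Kurzweil_Integration.integrable_combine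
        [of a "a + real m * h" "a + real (Suc m) * h" f]) (auto simp: algebra_simps)
qed

section \<open>The nodal basis\<close>

text \<open>
  The integer \<open>e\<close> belongs to exactly one residue class, so each end node of an element carries
  exactly one basis function, also when \<open>n\<close> is 1 or 2 and supports overlap.
\<close>

lemma sum_over_residue_indicator:
  assumes "n \<ge> 1"
  shows "(\<Sum>i<n. if e mod int n = int i then w else 0) = (w :: real)"
proof -
  have eq: "(e mod int n = int i) = (i = nat (e mod int n))" for i
    using assms by (auto simp: nat_eq_iff)
  have "nat (e mod int n) < n"
    using assms by (simp add: nat_less_iff)
  then show ?thesis
    unfolding eq by (subst sum.delta) auto
qed

definition basis_slope :: "nat \<Rightarrow> real \<Rightarrow> nat \<Rightarrow> int \<Rightarrow> real" where
  "basis_slope n h i e =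
     ((if (e + 1) mod int n = int i then 1 else 0) - (if e mod int n = int i then 1 else 0)) / h"

lemma basis_slope_sum:
  assumes "n \<ge> 1"
  shows "(\<Sum>i<n. basis_slope n h i e) = 0"
  using sum_over_residue_indicator[OF assms, where w = 1]
  by (simp add: basis_slope_def sum_subtractf flip: sum_divide_distrib)

lemma deriv_basis_fun:
  assumes h: "h > 0" and x: "x \<in> {node a h e<..<node a h (e + 1)}"
  shows "deriv (basis_fun n a h i) x = basis_slope n h i e"
proof (rule DERIV_imp_deriv)
  let ?l = "\<lambda>x. basis_fun n a h i (node a h e) * ((node a h (e + 1) - x) / h)
              + basis_fun n a h i (node a h (e + 1)) * ((x - node a h e) / h)"
  have "(?l has_field_derivative basis_slope n h i e) (at x)"
    unfolding basis_slope_def basis_fun_node[OF h] using h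
    by (auto intro!: derivative_eq_intros simp: field_simps)
  then show "(basis_fun n a h i has_field_derivative basis_slope n h i e) (at x)"
    by (rule has_field_derivative_transform_within_open[OF _ open_greaterThanLessThan x])
      (rule basis_fun_linear[OF h, symmetric], auto)
qed

lemma continuous_on_basis_fun:
  assumes h: "h > 0"
  shows "continuous_on {node a h e..node a h (e + 1)} (basis_fun n a h i)"
proof -
  have "continuous_on {node a h e..node a h (e + 1)}
      (\<lambda>x. basis_fun n a h i (node a h e) * ((node a h (e + 1) - x) / h)
         + basis_fun n a h i (node a h (e + 1)) * ((x - node a h e) / h))"
    using h by (intro continuous_intros) auto
  then show ?thesis
    by (rule continuous_on_eq) (use basis_fun_linear[OF h] in force)
qed

lemma element_continuous_basis_fun:
  assumes "h > 0"
  shows "element_continuous a h (basis_fun n a h i)"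
  unfolding element_continuous_def using continuous_on_basis_fun[OF assms] by blast

lemma element_continuous_deriv_basis_fun:
  assumes "h > 0"
  shows "element_continuous a h (deriv (basis_fun n a h i))"
  unfolding element_continuous_def
proof
  fix e
  show "\<exists>g. continuous_on {node a h e..node a h (e + 1)} g \<and>
      (\<forall>x\<in>{node a h e<..<node a h (e + 1)}. deriv (basis_fun n a h i) x = g x)"
    using deriv_basis_fun[OF assms] by (intro exI[of _ "\<lambda>_. basis_slope n h i e"]) simp
qed

lemma sum_deriv_basis_fun_eq_0:
  assumes n: "n \<ge> 1" and h: "h > 0" and x: "x \<notin> range (node a h)"
  shows "(\<Sum>j<n. deriv (basis_fun n a h j) x) = 0"
proof -
  define e where "e = \<lfloor>(x - a) / h\<rfloor>"
  have "of_int e \<le> (x - a) / h" "(x - a) / h < of_int e + 1"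
    by (simp_all add: e_def)
  then have "node a h e \<le> x" "x < node a h (e + 1)"
    using h by (auto simp: node_def field_simps)
  moreover have "x \<noteq> node a h e" using x by blast
  ultimately have "x \<in> {node a h e<..<node a h (e + 1)}" by simp
  then show ?thesis
    by (simp add: deriv_basis_fun[OF h] basis_slope_sum[OF n])
qed

text \<open>
  Both the convection and the diffusion matrix have this shape in the column index, with \<open>g\<close> a
  basis function or its derivative.
\<close>

lemma integral_against_sum_deriv_basis_fun:
  assumes n: "n \<ge> 1" and h: "h > 0" and g: "element_continuous a h g"
  shows "(\<Sum>j<n. integral {a..a + real n * h} (\<lambda>x. g x * deriv (basis_fun n a h j) x)) = 0"
proof -
  let ?I = "{a..a + real n * h}"
  have "(\<Sum>j<n. integral ?I (\<lambda>x. g x * deriv (basis_fun n a h j) x))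
      = integral ?I (\<lambda>x. \<Sum>j<n. g x * deriv (basis_fun n a h j) x)"
    by (intro Henstock_Kurzweil_Integration.integral_sum[symmetric] element_continuous_integrable h
        element_continuous_mult g element_continuous_deriv_basis_fun) auto
  also have "\<dots> = integral ?I (\<lambda>x. 0)"
  proof (rule integral_spike)
    show "negligible (range (node a h))"
      by (auto simp: negligible_iff_null_sets
          intro!: null_sets_completionI countable_imp_null_set_lborel)
    show "0 = (\<Sum>j<n. g x * deriv (basis_fun n a h j) x)" if "x \<in> ?I - range (node a h)" for x
      using that sum_deriv_basis_fun_eq_0[OF n h, of x a] by (simp flip: sum_distrib_left)
  qed
  finally show ?thesis by simp
qed

section \<open>The finite element matrices\<close>

lemma matrix_carriers [simp]:
  "mass_matrix n a h \<in> carrier_mat n n"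
  "convection_matrix n a h \<in> carrier_mat n n"
  "diffusion_matrix n a h \<in> carrier_mat n n"
  by (simp_all add: mass_matrix_def convection_matrix_def diffusion_matrix_def)

lemma convection_diffusion_annihilate_constants:
  assumes "n \<ge> 1" and "h > 0"
  shows "convection_matrix n a h *\<^sub>v vec n (\<lambda>_. 1) = 0\<^sub>v n"
    and "diffusion_matrix n a h *\<^sub>v vec n (\<lambda>_. 1) = 0\<^sub>v n"
  using integral_against_sum_deriv_basis_fun[OF assms element_continuous_basis_fun[OF assms(2)]]
    integral_against_sum_deriv_basis_fun[OF assms element_continuous_deriv_basis_fun[OF assms(2)]]
  by (auto simp: convection_matrix_def diffusion_matrix_def scalar_prod_def lessThan_atLeast0
      intro!: eq_vecI)

text \<open>
  With \<open>f = \<Sum>\<^sub>j v\<^sub>j N\<^sub>j\<close>, the equation \<open>M v = 0\<close> says that \<open>f\<close> is orthogonal to every basis function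
  and so to itself. Continuity on the closed element that starts at node \<open>e\<close> then forces
  \<open>v\<^sub>e = f(x\<^sub>e) = 0\<close>.
\<close>

lemma mass_matrix_kernel:
  assumes h: "h > 0" and v: "v \<in> carrier_vec n"
    and Mv: "mass_matrix n a h *\<^sub>v v = 0\<^sub>v n"
  shows "v = 0\<^sub>v n"
proof (rule eq_vecI)
  let ?I = "{a..a + real n * h}"
  let ?N = "basis_fun n a h"
  define f where "f x = (\<Sum>j<n. v $ j * ?N j x)" for x
  have NN: "(\<lambda>x. ?N i x * ?N j x) integrable_on ?I" for i j
    by (intro element_continuous_integrable h element_continuous_mult element_continuous_basis_fun)
  have Nf: "(\<lambda>x. ?N i x * f x) integrable_on ?I" "integral ?I (\<lambda>x. ?N i x * f x) = 0" if "i < n" for i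
  proof -
    have eq: "?N i x * f x = (\<Sum>j<n. v $ j * (?N i x * ?N j x))" for x
      by (simp add: f_def sum_distrib_left algebra_simps)
    show "(\<lambda>x. ?N i x * f x) integrable_on ?I"
      unfolding eq by (intro integrable_sum integrable_on_mult_right NN) auto
    have "integral ?I (\<lambda>x. ?N i x * f x) = (\<Sum>j<n. integral ?I (\<lambda>x. v $ j * (?N i x * ?N j x)))"
      unfolding eq
      by (intro Henstock_Kurzweil_Integration.integral_sum integrable_on_mult_right NN) auto
    also have "\<dots> = (mass_matrix n a h *\<^sub>v v) $ i"
      using that v by (auto simp: mass_matrix_def scalar_prod_def lessThan_atLeast0 intro!: sum.cong)
    finally show "integral ?I (\<lambda>x. ?N i x * f x) = 0"
      using Mv that by simp
  qed
  have sq: "f x * f x = (\<Sum>i<n. v $ i * (?N i x * f x))" for x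
  proof -
    have "f x * f x = (\<Sum>i<n. v $ i * ?N i x) * f x"
      by (simp add: f_def)
    then show ?thesis
      by (simp only: sum_distrib_right mult.assoc)
  qed
  have ff: "(\<lambda>x. f x * f x) integrable_on ?I"
    unfolding sq using Nf(1) by (intro integrable_sum integrable_on_mult_right) auto
  have "integral ?I (\<lambda>x. f x * f x) = (\<Sum>i<n. integral ?I (\<lambda>x. v $ i * (?N i x * f x)))"
    unfolding sq using Nf(1)
    by (intro Henstock_Kurzweil_Integration.integral_sum integrable_on_mult_right) auto
  also have "\<dots> = 0" using Nf(2) by simp
  finally have zero: "integral ?I (\<lambda>x. f x * f x) = 0" .
  fix e assume "e < dim_vec (0\<^sub>v n :: real vec)"
  then have e: "e < n" by simp
  let ?J = "{node a h (int e)..node a h (int e + 1)}"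
  have cont: "continuous_on ?J (\<lambda>x. f x * f x)"
    unfolding f_def by (intro continuous_intros continuous_on_basis_fun h)
  have "real (e + 1) * h \<le> real n * h"
    using e h by (intro mult_right_mono) auto
  then have sub: "?J \<subseteq> ?I"
    using h by (auto simp: node_def add.commute intro: order_trans[rotated])
  have "integral ?J (\<lambda>x. f x * f x) \<le> integral ?I (\<lambda>x. f x * f x)"
    using sub integrable_continuous_real[OF cont] ff by (intro integral_subset_le) auto
  moreover have "0 \<le> integral ?J (\<lambda>x. f x * f x)"
    using cont by (intro Henstock_Kurzweil_Integration.integral_nonneg integrable_continuous_real) auto
  ultimately have "integral ?J (\<lambda>x. f x * f x) = 0"
    using zero by simp
  then have "f (node a h (int e)) * f (node a h (int e)) = 0"
    using cont h by (subst (asm) integral_eq_0_iff) (auto simp: node_def)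
  then have "f (node a h (int e)) = 0" by simp
  moreover have "f (node a h (int e)) = (\<Sum>j<n. if j = e then v $ e else 0)"
    unfolding f_def basis_fun_node[OF h] using e by (intro sum.cong) auto
  ultimately show "v $ e = 0\<^sub>v n $ e"
    using e by simp
qed (use v in simp)

lemma mass_matrix_inverse_carrier:
  assumes "h > 0"
  shows "the (mat_inverse (mass_matrix n a h)) \<in> carrier_mat n n"
proof (cases "mat_inverse (mass_matrix n a h)")
  case None
  have "Determinant.det (mass_matrix n a h) \<noteq> 0"
    using mass_matrix_kernel[OF assms] det_0_iff_vec_prod_zero[of "mass_matrix n a h" n] by auto
  then have "mass_matrix n a h \<in> Units (ring_mat TYPE(real) n ())"
    by (intro det_non_zero_imp_unit) auto
  moreover have "mass_matrix n a h \<notin> Units (ring_mat TYPE(real) n ())"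
    by (rule mat_inverse(1)[OF _ None]) simp
  ultimately show ?thesis by blast
next
  case (Some B)
  then show ?thesis
    using mat_inverse(2)[of "mass_matrix n a h" n B] by simp
qed

lemma mrsu_matrix_carrier:
  assumes "h > 0"
  shows "mrsu_matrix n a h c lam \<in> carrier_mat n n"
  unfolding mrsu_matrix_def using mass_matrix_inverse_carrier[OF assms, of n a]
  by (intro mult_carrier_mat[of _ n n]) auto

lemma mrsu_matrix_annihilates_constants:
  assumes "n \<ge> 1" and h: "h > 0"
  shows "mrsu_matrix n a h c lam *\<^sub>v vec n (\<lambda>_. 1) = 0\<^sub>v n"
proof -
  let ?B = "c \<cdot>\<^sub>m convection_matrix n a h + (h / 2 * lam) \<cdot>\<^sub>m diffusion_matrix n a h"
  have B: "?B \<in> carrier_mat n n" by simp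
  have smult: "(r \<cdot>\<^sub>m A) *\<^sub>v w = r \<cdot>\<^sub>v (A *\<^sub>v w)"
    if "A \<in> carrier_mat n n" "w \<in> carrier_vec n" for r :: real and A w
    using that by (auto intro!: eq_vecI simp: scalar_prod_def sum_distrib_left algebra_simps)
  have "?B *\<^sub>v vec n (\<lambda>_. 1) = 0\<^sub>v n"
    by (subst add_mult_distrib_mat_vec[of _ n n])
      (auto simp: smult convection_diffusion_annihilate_constants[OF assms])
  moreover have "the (mat_inverse (mass_matrix n a h)) *\<^sub>v 0\<^sub>v n = 0\<^sub>v n"
    using mass_matrix_inverse_carrier[OF h, of n a] by auto
  ultimately show ?thesis
    unfolding mrsu_matrix_def
    by (subst assoc_mult_mat_vec[OF mass_matrix_inverse_carrier[OF h] B]) auto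
qed

section \<open>The critical time step\<close>

theorem theorem11p1:
  fixes a h c lam dt_cr :: real and n :: nat and nrm :: "real mat \<Rightarrow> real"
  assumes "n \<ge> 1" and "h > 0" and "lam > 0"
    and "submultiplicative_norm n nrm"
    and "critical_time_step nrm n a h c lam dt_cr"
  shows "dt_cr \<le> 1 / spectral_radius (map_mat complex_of_real
           ((1 / dt_cr) \<cdot>\<^sub>m 1\<^sub>m n
            - the (mat_inverse (mass_matrix n a h)) *
                (c \<cdot>\<^sub>m convection_matrix n a h + (h / 2 * lam) \<cdot>\<^sub>m diffusion_matrix n a h)))"
proof -
  let ?K = "mrsu_matrix n a h c lam"
  let ?B = "(1 / dt_cr) \<cdot>\<^sub>m 1\<^sub>m n - ?K"
  let ?Bc = "map_mat complex_of_real ?B"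
  let ?A = "amplification_matrix n a h c lam dt_cr"
  let ?one = "vec n (\<lambda>_. 1) :: real vec"
  have K: "?K \<in> carrier_mat n n" using assms(2) by (rule mrsu_matrix_carrier)
  have Bc: "?Bc \<in> carrier_mat n n" using K by auto
  have n: "n > 0" using assms(1) by simp
  have dt: "dt_cr > 0" and stable: "\<And>k. nrm (?A ^\<^sub>m (k + 1)) \<le> 1"
    using assms(5) by (auto simp: critical_time_step_def mrsu_stable_def)
  have A: "?A \<in> carrier_mat n n" using K by (auto simp: amplification_matrix_def)
  have A_eq: "map_mat complex_of_real ?A = of_real dt_cr \<cdot>\<^sub>m ?Bc"
    using K dt by (auto intro!: eq_matI simp: amplification_matrix_def right_diff_distrib)
  \<comment> \<open>Spectral values of the real matrix may be complex, so the bound is proved over the complex field.\<close>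
  have upper: "norm \<mu> \<le> 1 / dt_cr" if "\<mu> \<in> spectrum ?Bc" for \<mu>
  proof -
    obtain v where ev: "eigenvector ?Bc v \<mu>"
      using \<open>\<mu> \<in> spectrum ?Bc\<close> by (auto simp: spectrum_def eigenvalue_def)
    have v: "v \<in> carrier_vec n" "?Bc *\<^sub>v v = \<mu> \<cdot>\<^sub>v v" "v \<noteq> 0\<^sub>v n"
      using ev K by (auto simp: eigenvector_def)
    have "(of_real dt_cr \<cdot>\<^sub>m ?Bc) *\<^sub>v v = of_real dt_cr \<cdot>\<^sub>v (?Bc *\<^sub>v v)"
      using Bc v(1) by (auto intro!: eq_vecI simp: scalar_prod_def sum_distrib_left algebra_simps)
    then have "eigenvector (map_mat complex_of_real ?A) v (of_real dt_cr * \<mu>)"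
      unfolding v(2) using v(1,3) K by (simp add: eigenvector_def A_eq smult_smult_assoc)
    from eigenvalue_le_1_of_power_bounded[OF assms(4) A stable this]
    show ?thesis using dt by (simp add: norm_mult field_simps)
  qed
  \<comment> \<open>The constant vector is an eigenvector, which keeps the spectral radius away from 0.\<close>
  have one: "map_vec complex_of_real ?one \<in> carrier_vec n" by simp
  have B_one: "?B *\<^sub>v ?one = (1 / dt_cr) \<cdot>\<^sub>v ?one"
  proof -
    have "?B *\<^sub>v ?one = ((1 / dt_cr) \<cdot>\<^sub>m 1\<^sub>m n) *\<^sub>v ?one - ?K *\<^sub>v ?one"
      using K by (intro minus_mult_distrib_mat_vec) auto
    also have "((1 / dt_cr) \<cdot>\<^sub>m 1\<^sub>m n) *\<^sub>v ?one = (1 / dt_cr) \<cdot>\<^sub>v ?one"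
      by (auto intro!: eq_vecI simp: scalar_prod_def if_distrib if_distribR
          sum.delta sum.delta' cong: if_cong)
    finally show ?thesis
      unfolding mrsu_matrix_annihilates_constants[OF assms(1,2)] by auto
  qed
  have "?Bc *\<^sub>v map_vec complex_of_real ?one = map_vec complex_of_real (?B *\<^sub>v ?one)"
    using K by (intro of_real_hom.mult_mat_vec_hom[symmetric, of _ n n]) auto
  also have "\<dots> = of_real (1 / dt_cr) \<cdot>\<^sub>v map_vec complex_of_real ?one"
    unfolding B_one by (auto intro!: eq_vecI)
  finally have eig: "?Bc *\<^sub>v map_vec complex_of_real ?one
      = of_real (1 / dt_cr) \<cdot>\<^sub>v map_vec complex_of_real ?one" .
  have "map_vec complex_of_real ?one $ 0 \<noteq> 0\<^sub>v n $ 0" using n by simp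
  then have "map_vec complex_of_real ?one \<noteq> 0\<^sub>v n" by metis
  then have "eigenvector ?Bc (map_vec complex_of_real ?one) (of_real (1 / dt_cr))"
    unfolding eigenvector_def using eig one Bc by (metis carrier_matD(1))
  then have "of_real (1 / dt_cr) \<in> spectrum ?Bc"
    unfolding spectrum_def eigenvalue_def by blast
  then have "norm (complex_of_real (1 / dt_cr)) \<le> spectral_radius ?Bc"
    by (intro spectral_radius_mem_max(2)[OF Bc n]) auto
  then have pos: "0 < spectral_radius ?Bc"
    using dt by (smt (verit) norm_of_real divide_pos_pos abs_of_pos)
  moreover have "spectral_radius ?Bc \<le> 1 / dt_cr"
    using spectral_radius_mem_max(1)[OF Bc n] upper by auto
  ultimately have "dt_cr \<le> 1 / spectral_radius ?Bc"
    using dt by (simp add: field_simps)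
  then show ?thesis unfolding mrsu_matrix_def .
qed

end
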